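(* Let $v,d,q\ge1$ be integers and let $\xi^*\in D(v,d,q1_d)$ be an exact block design satisfying (i) for every $1\le k\le d$: $\xi^*(0,k)=q/2$ if $q$ is even, and $\xi^*(0,k)\in\{\lfloor q/2\rfloor,\lfloor q/2\rfloor+1\}$ if $q$ is odd; and (ii) $\mu_{01}(\xi^* )=\cdots=\mu_{0v}(\xi^* )$. Then $\xi^*$ is optimal for $\left(\sum_{i=1}^v\tau_i\right)/v-\tau_0$ in $D(v,d,q1_d)$, i.e. it minimizes the variance of the least squares estimator of this contrast, and it minimizes $$\sum_{i=1}^v\mathrm{Var}(\widehat{\tau_i-\tau_0})+\sum_{1\le i\ne j\le v}\left|\mathrm{Cov}(\widehat{\tau_i-\tau_0},\widehat{\tau_j-\tau_0})\right|$$ over $D(v,d,q1_d)$.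
   Context: Treatments are labelled $0,1,\dots,v$ ($0$ is the control, the others are test treatments); blocks are labelled $1,\dots,d$. The model is $Y_j=\mu+\tau_{i(j)}+\theta_{k(j)}+\varepsilon_j$, $j=1,\dots,n$, with treatment effects $\tau=(\tau_0,\dots,\tau_v)^T$, block effects $\theta_1,\dots,\theta_d$, and uncorrelated zero-mean errors of common variance $\sigma^2<\infty$. $D(v,d,q1_d)$ is the class of exact block designs with all $d$ blocks of size $q$: functions $\xi:\{0,\dots,v\}\times\{1,\dots,d\}\to\{0,1,2,\dots\}$ with $\sum_{i=0}^v\xi(i,k)=q$ for every $k$; $\xi(i,k)$ is the number of trials with treatment $i$ in block $k$, and $n=dq$. Put $r_i(\xi)=\sum_k\xi(i,k)$, $r=(r_0,\dots,r_v)^T$, $\mu_{ij}(\xi)=\sum_{k=1}^d\xi(i,k)\xi(j,k)$, $X(\xi)=(\xi(i,k))_{0\le i\le v,\,1\le k\le d}$, $Z(\xi)=(\xi(i,k))_{1\le i\le v,\,1\le k\le d}$. Let $M(\xi)=\mathrm{diag}(r)-\frac1qXX^T$ and $Q=(-1_v,I_v)^T$ ($1_v$ the all-ones vector), so $Q^T\tau=(\tau_1-\tau_0,\dots,\tau_v-\tau_0)^T$. The design is feasible if the column space of $Q$ is contained in that of $M(\xi)$. For feasible $\xi$ the information matrix for treatment-control comparisons is $$N(\xi)=\mathrm{diag}(r_1,\dots,r_v)-\tfrac1qZZ^T=(Q^TM^-(\xi)Q)^{-1},$$ and the covariance matrix of the least squares estimators $\widehat{\tau_1-\tau_0},\dots,\widehat{\tau_v-\tau_0}$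 is $\sigma^2N^{-1}(\xi)$; the variance of the least squares estimator of $(\sum_{i=1}^v\tau_i)/v-\tau_0$ is $\sigma^2\,1_v^TN^{-1}(\xi)1_v/v^2$. For designs that are not feasible both minimized quantities are taken to be $+\infty$. *)

theory Defs
  imports "HOL-Probability.Probability" "Jordan_Normal_Form.VS_Connect"
begin

(* Treatments are 0..v (0 is the control), blocks are 1..d, trials are 1..n with n = d * q.
   Designs and layouts are functions on nat; their values outside these ranges are irrelevant. *)

definition block_designs :: "nat \<Rightarrow> nat \<Rightarrow> nat \<Rightarrow> (nat \<Rightarrow> nat \<Rightarrow> nat) set" where
  "block_designs v d q = {\<xi>. \<forall>k\<in>{1..d}. (\<Sum>i=0..v. \<xi> i k) = q}"

definition replications :: "nat \<Rightarrow> (nat \<Rightarrow> nat \<Rightarrow> nat) \<Rightarrow> nat \<Rightarrow> nat" where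
  "replications d \<xi> i = (\<Sum>k=1..d. \<xi> i k)"

definition concurrence :: "nat \<Rightarrow> (nat \<Rightarrow> nat \<Rightarrow> nat) \<Rightarrow> nat \<Rightarrow> nat \<Rightarrow> nat" where
  "concurrence d \<xi> i j = (\<Sum>k=1..d. \<xi> i k * \<xi> j k)"

(* Matrix indices start at 0: column k of the incidence matrix is block k + 1, and column j of
   the contrast matrix is the comparison of test treatment j + 1 with the control. *)

definition incidence_matrix :: "nat \<Rightarrow> nat \<Rightarrow> (nat \<Rightarrow> nat \<Rightarrow> nat) \<Rightarrow> real mat" where
  "incidence_matrix v d \<xi> = mat (v + 1) d (\<lambda>(i, k). real (\<xi> i (k + 1)))"

definition treatment_information ::
  "nat \<Rightarrow> nat \<Rightarrow> nat \<Rightarrow> (nat \<Rightarrow> nat \<Rightarrow> nat) \<Rightarrow> real mat" where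
  "treatment_information v d q \<xi> =
     mat (v + 1) (v + 1) (\<lambda>(i, j). if i = j then real (replications d \<xi> i) else 0)
     - (1 / real q) \<cdot>\<^sub>m (incidence_matrix v d \<xi> * transpose_mat (incidence_matrix v d \<xi>))"

definition control_contrasts :: "nat \<Rightarrow> real mat" where
  "control_contrasts v =
     mat (v + 1) v (\<lambda>(i, j). if i = 0 then - 1 else if i = j + 1 then 1 else 0)"

definition feasible :: "nat \<Rightarrow> nat \<Rightarrow> nat \<Rightarrow> (nat \<Rightarrow> nat \<Rightarrow> nat) \<Rightarrow> bool" where
  "feasible v d q \<xi> \<longleftrightarrow>
     vec_space.col_space (v + 1) (control_contrasts v)
       \<subseteq> vec_space.col_space (v + 1) (treatment_information v d q \<xi>)"

(* The layout (t, b) assigns to trial j the treatment t j and the block b j. *)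

definition realizes ::
  "nat \<Rightarrow> nat \<Rightarrow> nat \<Rightarrow> (nat \<Rightarrow> nat \<Rightarrow> nat) \<Rightarrow> (nat \<Rightarrow> nat) \<Rightarrow> (nat \<Rightarrow> nat) \<Rightarrow> bool" where
  "realizes v d q \<xi> t b \<longleftrightarrow>
     (\<forall>j\<in>{1..d * q}. t j \<in> {0..v} \<and> b j \<in> {1..d}) \<and>
     (\<forall>i\<in>{0..v}. \<forall>k\<in>{1..d}. card {j\<in>{1..d * q}. t j = i \<and> b j = k} = \<xi> i k)"

definition residual_sum_of_squares ::
  "nat \<Rightarrow> (nat \<Rightarrow> nat) \<Rightarrow> (nat \<Rightarrow> nat) \<Rightarrow> (nat \<Rightarrow> real) \<Rightarrow>
   real \<times> (nat \<Rightarrow> real) \<times> (nat \<Rightarrow> real) \<Rightarrow> real" where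
  "residual_sum_of_squares n t b y =
     (\<lambda>(\<mu>, \<tau>, \<theta>). \<Sum>j=1..n. (y j - (\<mu> + \<tau> (t j) + \<theta> (b j)))\<^sup>2)"

(* The minimizer is not unique, so a fitted \<tau> is only meaningful through estimable functions
   of it; for a feasible design these include all contrasts considered here. *)

definition fitted_treatment_effects ::
  "nat \<Rightarrow> (nat \<Rightarrow> nat) \<Rightarrow> (nat \<Rightarrow> nat) \<Rightarrow> (nat \<Rightarrow> real) \<Rightarrow> nat \<Rightarrow> real" where
  "fitted_treatment_effects n t b y =
     fst (snd (arg_min (residual_sum_of_squares n t b y) (\<lambda>_. True)))"

definition observation ::
  "(nat \<Rightarrow> nat) \<Rightarrow> (nat \<Rightarrow> nat) \<Rightarrow> real \<Rightarrow> (nat \<Rightarrow> real) \<Rightarrow> (nat \<Rightarrow> real) \<Rightarrow>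
   (nat \<Rightarrow> 'p \<Rightarrow> real) \<Rightarrow> nat \<Rightarrow> 'p \<Rightarrow> real" where
  "observation t b \<mu> \<tau> \<theta> \<epsilon> j \<omega> = \<mu> + \<tau> (t j) + \<theta> (b j) + \<epsilon> j \<omega>"

definition control_comparison_lse ::
  "nat \<Rightarrow> (nat \<Rightarrow> nat) \<Rightarrow> (nat \<Rightarrow> nat) \<Rightarrow> (nat \<Rightarrow> 'p \<Rightarrow> real) \<Rightarrow> nat \<Rightarrow> 'p \<Rightarrow> real" where
  "control_comparison_lse n t b Y i \<omega> =
     (let \<tau> = fitted_treatment_effects n t b (\<lambda>j. Y j \<omega>) in \<tau> i - \<tau> 0)"

definition average_comparison_lse ::
  "nat \<Rightarrow> nat \<Rightarrow> (nat \<Rightarrow> nat) \<Rightarrow> (nat \<Rightarrow> nat) \<Rightarrow> (nat \<Rightarrow> 'p \<Rightarrow> real) \<Rightarrow> 'p \<Rightarrow> real" where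
  "average_comparison_lse v n t b Y \<omega> =
     (let \<tau> = fitted_treatment_effects n t b (\<lambda>j. Y j \<omega>) in (\<Sum>i=1..v. \<tau> i) / real v - \<tau> 0)"

definition covariance :: "'p measure \<Rightarrow> ('p \<Rightarrow> real) \<Rightarrow> ('p \<Rightarrow> real) \<Rightarrow> real" where
  "covariance P U V =
     (LINT \<omega>|P. (U \<omega> - (LINT x|P. U x)) * (V \<omega> - (LINT x|P. V x)))"

definition uncorrelated_errors ::
  "'p measure \<Rightarrow> nat \<Rightarrow> real \<Rightarrow> (nat \<Rightarrow> 'p \<Rightarrow> real) \<Rightarrow> bool" where
  "uncorrelated_errors P n \<sigma> \<epsilon> \<longleftrightarrow>
     (\<forall>j\<in>{1..n}. \<epsilon> j \<in> borel_measurable P \<and> integrable P (\<lambda>\<omega>. (\<epsilon> j \<omega>)\<^sup>2) \<and>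
        (LINT \<omega>|P. \<epsilon> j \<omega>) = 0 \<and> prob_space.variance P (\<epsilon> j) = \<sigma>\<^sup>2) \<and>
     (\<forall>j\<in>{1..n}. \<forall>l\<in>{1..n}. j \<noteq> l \<longrightarrow> covariance P (\<epsilon> j) (\<epsilon> l) = 0)"

definition average_criterion ::
  "'p measure \<Rightarrow> nat \<Rightarrow> nat \<Rightarrow> nat \<Rightarrow> real \<Rightarrow> (nat \<Rightarrow> real) \<Rightarrow> (nat \<Rightarrow> real) \<Rightarrow>
   (nat \<Rightarrow> 'p \<Rightarrow> real) \<Rightarrow> (nat \<Rightarrow> nat \<Rightarrow> nat) \<Rightarrow> (nat \<Rightarrow> nat) \<Rightarrow> (nat \<Rightarrow> nat) \<Rightarrow> ereal" where
  "average_criterion P v d q \<mu> \<tau> \<theta> \<epsilon> \<xi> t b =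
     (if feasible v d q \<xi>
      then ereal (prob_space.variance P
        (average_comparison_lse v (d * q) t b (observation t b \<mu> \<tau> \<theta> \<epsilon>)))
      else \<infinity>)"

definition absolute_covariance_criterion ::
  "'p measure \<Rightarrow> nat \<Rightarrow> nat \<Rightarrow> nat \<Rightarrow> real \<Rightarrow> (nat \<Rightarrow> real) \<Rightarrow> (nat \<Rightarrow> real) \<Rightarrow>
   (nat \<Rightarrow> 'p \<Rightarrow> real) \<Rightarrow> (nat \<Rightarrow> nat \<Rightarrow> nat) \<Rightarrow> (nat \<Rightarrow> nat) \<Rightarrow> (nat \<Rightarrow> nat) \<Rightarrow> ereal" where
  "absolute_covariance_criterion P v d q \<mu> \<tau> \<theta> \<epsilon> \<xi> t b =
     (if feasible v d q \<xi>
      then let \<delta> = control_comparison_lse (d * q) t b (observation t b \<mu> \<tau> \<theta> \<epsilon>) in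
        ereal ((\<Sum>i=1..v. prob_space.variance P (\<delta> i))
          + (\<Sum>i=1..v. \<Sum>j\<in>{1..v} - {i}. \<bar>covariance P (\<delta> i) (\<delta> j)\<bar>))
      else \<infinity>)"

end

theory Submission
  imports Defs
begin

text \<open>Write \<open>M\<close> for the treatment information matrix (\<open>information_map\<close> is \<open>w \<mapsto> M w\<close>) and let \<open>e\<^sub>0, \<dots>, e\<^sub>v\<close>
be the unit vectors. If \<open>M w = a\<close>, the least squares estimator of \<open>a\<^sup>T \<tau>\<close> is the linear statistic whose
coefficients are the treatment values of \<open>w\<close> centred within blocks
(\<open>estimable_contrast_estimator\<close>), and the covariance of two such estimators is \<open>\<sigma>\<^sup>2 w\<^sup>T M x\<close>
(\<open>covariance_estimable_contrasts\<close>). Feasibility means that \<open>M w = e\<^sub>l - e\<^sub>0\<close> is solvable for every test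
treatment \<open>l\<close>, so all the variances can be read off from solutions of these equations, without
forming \<open>N(\<xi>)\<close> or inverting a matrix.

Let \<open>a\<close> be the vector of the contrast ``mean of the test treatments minus control'', let \<open>M u = a\<close>,
and let \<open>s\<close> be the indicator of the test treatments. Then \<open>s\<^sup>T M u = s\<^sup>T a = 1\<close> while
\<open>s\<^sup>T M s = S/q\<close> with \<open>S = \<Sum>\<^sub>k \<xi>(0,k) (q - \<xi>(0,k))\<close>, and the Cauchy-Schwarz inequality for the form \<open>M\<close>
gives \<open>u\<^sup>T M u \<ge> q/S\<close> (\<open>average_variance_lower_bound\<close>). Splitting every block as evenly as possible
between control and tests maximizes \<open>S\<close> (\<open>balanced_split_maximal\<close>). If moreover all control
concurrences agree, then \<open>M s\<close> is the multiple \<open>(S/q) a\<close>, so \<open>u\<^sup>T M u = q/S\<close> exactly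
(\<open>average_variance_balanced\<close>). This settles the first criterion.

Without the absolute values, the second criterion is the sum of all entries of the covariance matrix,
that is \<open>v\<^sup>2\<close> times the first criterion; with them it can only be larger. Hence it suffices that
the candidate design has nonnegative covariances. This follows from a minimum principle:
\<open>(M w)\<^sub>i\<close> is a nonnegative combination of the differences \<open>w\<^sub>i - w\<^sub>m\<close>, so if
\<open>(M w)\<^sub>i \<ge> 0\<close> at all tests and the control meets every test, then \<open>w\<close> is smallest at the control
(\<open>information_minimum_principle\<close>). The same principle shows that the kernel of \<open>M\<close> is then spanned by the
all-ones vector, which makes the candidate feasible.\<close>

section \<open>Normal equations\<close>

text \<open>Every vector \<open>y\<close> has an orthogonal projection onto the span of finitely many columns \<open>A k\<close>. The proof is
Gram-Schmidt by induction on the columns: \<open>e\<close>, the part of the new column orthogonal to the old span,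
is used to correct the previous residual. The design columns give the
existence of a least squares fit; the columns of the information matrix give the equations that decide
feasibility.\<close>

lemma normal_equations_solvable:
  fixes A :: "'i \<Rightarrow> 'j \<Rightarrow> real"
  assumes "finite I"
  shows "\<exists>c. \<forall>i\<in>I. (\<Sum>j\<in>J. (y j - (\<Sum>k\<in>I. c k * A k j)) * A i j) = 0"
  using assms
proof (induction I arbitrary: y rule: finite_induct)
  case empty
  show ?case by simp
next
  case (insert x I)
  obtain c where c: "\<And>i. i \<in> I \<Longrightarrow> (\<Sum>j\<in>J. (y j - (\<Sum>k\<in>I. c k * A k j)) * A i j) = 0"
    using insert.IH[of y] by blast
  obtain g where g: "\<And>i. i \<in> I \<Longrightarrow> (\<Sum>j\<in>J. (A x j - (\<Sum>k\<in>I. g k * A k j)) * A i j) = 0"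
    using insert.IH[of "A x"] by blast
  define r where "r j = y j - (\<Sum>k\<in>I. c k * A k j)" for j
  define e where "e j = A x j - (\<Sum>k\<in>I. g k * A k j)" for j
  \<comment> \<open>If the new column already lies in the old span, then \<open>e\<close> vanishes on \<open>J\<close>, and \<open>s = 0\<close> since \<open>x / 0 = 0\<close>;
    so the dependent case needs no other choice of coefficients.\<close>
  define s where "s = (\<Sum>j\<in>J. r j * e j) / (\<Sum>j\<in>J. e j * e j)"
  define h where "h k = (if k = x then s else c k - s * g k)" for k
  have res: "y j - (\<Sum>k\<in>insert x I. h k * A k j) = r j - s * e j" for j
  proof -
    have "(\<Sum>k\<in>I. h k * A k j) = (\<Sum>k\<in>I. c k * A k j) - s * (\<Sum>k\<in>I. g k * A k j)"
      using insert.hyps by (auto simp: h_def sum_distrib_left sum_subtractf[symmetric] algebra_simps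
          intro!: sum.cong)
    then show ?thesis
      using insert.hyps by (simp add: r_def e_def h_def algebra_simps)
  qed
  have orth: "(\<Sum>j\<in>J. (r j - s * e j) * A i j) = 0" if "i \<in> I" for i
  proof -
    have "(\<Sum>j\<in>J. (r j - s * e j) * A i j) = (\<Sum>j\<in>J. r j * A i j) - s * (\<Sum>j\<in>J. e j * A i j)"
      by (simp add: sum_distrib_left sum_subtractf algebra_simps)
    then show ?thesis using c[OF that] g[OF that] by (simp add: r_def e_def)
  qed
  have orth_e: "(\<Sum>j\<in>J. (r j - s * e j) * e j) = 0"
  proof -
    have eq: "(\<Sum>j\<in>J. (r j - s * e j) * e j) = (\<Sum>j\<in>J. r j * e j) - s * (\<Sum>j\<in>J. e j * e j)"
      by (simp add: sum_distrib_left sum_subtractf algebra_simps)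
    show ?thesis
    proof (cases "(\<Sum>j\<in>J. e j * e j) = 0")
      case True
      have "(\<Sum>j\<in>J. r j * e j) = 0"
      proof (cases "finite J")
        case True
        with \<open>(\<Sum>j\<in>J. e j * e j) = 0\<close> have "\<forall>j\<in>J. e j = 0"
          by (subst (asm) sum_nonneg_eq_0_iff) auto
        then show ?thesis by simp
      qed simp
      with True eq show ?thesis by simp
    next
      case False
      with eq show ?thesis by (simp add: s_def)
    qed
  qed
  have "(\<Sum>j\<in>J. (r j - s * e j) * A x j) = 0"
  proof -
    have "(\<Sum>j\<in>J. (r j - s * e j) * A x j)
        = (\<Sum>j\<in>J. (r j - s * e j) * e j + (\<Sum>k\<in>I. g k * ((r j - s * e j) * A k j)))"
    proof (intro sum.cong refl)
      fix j
      have "A x j = e j + (\<Sum>k\<in>I. g k * A k j)" by (simp add: e_def)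
      then show "(r j - s * e j) * A x j
          = (r j - s * e j) * e j + (\<Sum>k\<in>I. g k * ((r j - s * e j) * A k j))"
        by (simp only: distrib_left sum_distrib_left) (simp add: mult.left_commute)
    qed
    also have "\<dots> = (\<Sum>j\<in>J. (r j - s * e j) * e j)
        + (\<Sum>k\<in>I. g k * (\<Sum>j\<in>J. (r j - s * e j) * A k j))"
      by (simp add: sum.distrib sum_distrib_left sum.swap[of _ I J])
    also have "\<dots> = 0" using orth orth_e by simp
    finally show ?thesis .
  qed
  with orth show ?case
    by (intro exI[of _ h]) (simp only: res, auto)
qed

section \<open>The information matrix as an operator\<close>

lemma sum_split_control:
  fixes f :: "nat \<Rightarrow> 'a::comm_monoid_add"
  shows "(\<Sum>i=0..v. f i) = f 0 + (\<Sum>i=1..v. f i)"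
  by (simp add: sum.atLeast_Suc_atMost)

definition block_mean where
  "block_mean v q \<xi> w k = (\<Sum>i=0..v. real (\<xi> i k) * w i) / real q"
  for w :: "nat \<Rightarrow> real"

definition information_map where
  "information_map v d q \<xi> w i = (\<Sum>k=1..d. real (\<xi> i k) * (w i - block_mean v q \<xi> w k))"
  for w :: "nat \<Rightarrow> real"

lemma block_mean_linear:
  "block_mean v q \<xi> (\<lambda>i. \<Sum>l\<in>L. c l * w l i) k = (\<Sum>l\<in>L. c l * block_mean v q \<xi> (w l) k)"
proof -
  have "(\<Sum>i=0..v. real (\<xi> i k) * (\<Sum>l\<in>L. c l * w l i))
      = (\<Sum>l\<in>L. \<Sum>i=0..v. c l * (real (\<xi> i k) * w l i))"
    by (subst sum.swap) (simp add: sum_distrib_left mult.left_commute)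
  then show ?thesis
    by (simp add: block_mean_def sum_distrib_left sum_divide_distrib)
qed

lemma information_map_linear:
  "information_map v d q \<xi> (\<lambda>i. \<Sum>l\<in>L. c l * w l i) i
     = (\<Sum>l\<in>L. c l * information_map v d q \<xi> (w l) i)"
proof -
  have "real (\<xi> i k) * ((\<Sum>l\<in>L. c l * w l i) - (\<Sum>l\<in>L. c l * block_mean v q \<xi> (w l) k))
      = (\<Sum>l\<in>L. c l * (real (\<xi> i k) * (w l i - block_mean v q \<xi> (w l) k)))" for k
    by (simp only: sum_subtractf[symmetric] sum_distrib_left right_diff_distrib mult.left_commute)
  then show ?thesis
    unfolding information_map_def block_mean_linear sum_distrib_left
    by (subst sum.swap) (simp add: sum_distrib_left)
qed

lemma information_map_uminus:
  "information_map v d q \<xi> (\<lambda>i. - w i) i = - information_map v d q \<xi> w i"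
  using information_map_linear[of v d q \<xi> "\<lambda>_. -1" "\<lambda>_. w" "{()}" i] by simp

context
  fixes v d q :: nat and \<xi> :: "nat \<Rightarrow> nat \<Rightarrow> nat"
  assumes design: "\<xi> \<in> block_designs v d q" and q: "q \<ge> 1"
begin

lemma block_size: "k \<in> {1..d} \<Longrightarrow> (\<Sum>i=0..v. real (\<xi> i k)) = real q"
  using design unfolding block_designs_def of_nat_sum[symmetric] by simp

lemma block_deviations_sum:
  assumes "k \<in> {1..d}"
  shows "(\<Sum>i=0..v. real (\<xi> i k) * (w i - block_mean v q \<xi> w k)) = 0"
proof -
  have "(\<Sum>i=0..v. real (\<xi> i k) * (w i - block_mean v q \<xi> w k))
      = (\<Sum>i=0..v. real (\<xi> i k) * w i) - (\<Sum>i=0..v. real (\<xi> i k)) * block_mean v q \<xi> w k"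
    by (simp add: algebra_simps sum_subtractf sum_distrib_left)
  then show ?thesis using q block_size[OF assms] by (simp add: block_mean_def)
qed

text \<open>The right-hand side is \<open>x\<^sup>T M w\<close>. The identity exhibits it as an inner product of block-centred treatment
values, so that \<open>M\<close> is symmetric and positive semidefinite. Centring the second factor is harmless
because the deviations of the first one already sum to zero in every block.\<close>

lemma information_form:
  "(\<Sum>i=0..v. \<Sum>k=1..d. real (\<xi> i k)
       * ((w i - block_mean v q \<xi> w k) * (x i - block_mean v q \<xi> x k)))
     = (\<Sum>i=0..v. x i * information_map v d q \<xi> w i)"
proof -
  have "(\<Sum>i=0..v. \<Sum>k=1..d. real (\<xi> i k)
         * ((w i - block_mean v q \<xi> w k) * (x i - block_mean v q \<xi> x k)))
      = (\<Sum>i=0..v. x i * information_map v d q \<xi> w i)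
        - (\<Sum>i=0..v. \<Sum>k=1..d. block_mean v q \<xi> x k
            * (real (\<xi> i k) * (w i - block_mean v q \<xi> w k)))"
    unfolding information_map_def sum_distrib_left sum_subtractf[symmetric]
    by (intro sum.cong refl) (simp add: algebra_simps)
  also have "(\<Sum>i=0..v. \<Sum>k=1..d. block_mean v q \<xi> x k
            * (real (\<xi> i k) * (w i - block_mean v q \<xi> w k)))
      = (\<Sum>k=1..d. block_mean v q \<xi> x k
            * (\<Sum>i=0..v. real (\<xi> i k) * (w i - block_mean v q \<xi> w k)))"
    by (subst sum.swap) (simp add: sum_distrib_left)
  also have "\<dots> = 0" by (intro sum.neutral) (simp add: block_deviations_sum)
  finally show ?thesis by simp
qed

lemma information_map_symmetric:
  "(\<Sum>i=0..v. x i * information_map v d q \<xi> w i)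
     = (\<Sum>i=0..v. w i * information_map v d q \<xi> x i)"
  unfolding information_form[symmetric] by (simp only: mult.commute[of "w _ - _"])

lemma information_cauchy_schwarz:
  "(\<Sum>i=0..v. x i * information_map v d q \<xi> w i)\<^sup>2
     \<le> (\<Sum>i=0..v. w i * information_map v d q \<xi> w i)
       * (\<Sum>i=0..v. x i * information_map v d q \<xi> x i)"
proof -
  define f where "f w p = sqrt (real (\<xi> (fst p) (snd p)))
    * (w (fst p) - block_mean v q \<xi> w (snd p))" for w :: "nat \<Rightarrow> real" and p
  have form: "(\<Sum>p\<in>{0..v}\<times>{1..d}. f w p * f x p)
      = (\<Sum>i=0..v. x i * information_map v d q \<xi> w i)" for w x
  proof -
    have "f w p * f x p = real (\<xi> (fst p) (snd p)) * ((w (fst p) - block_mean v q \<xi> w (snd p))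
        * (x (fst p) - block_mean v q \<xi> x (snd p)))" for p
    proof -
      have "f w p * f x p = (sqrt (real (\<xi> (fst p) (snd p))) * sqrt (real (\<xi> (fst p) (snd p))))
          * ((w (fst p) - block_mean v q \<xi> w (snd p)) * (x (fst p) - block_mean v q \<xi> x (snd p)))"
        by (simp only: f_def mult_ac)
      then show ?thesis by simp
    qed
    then have "(\<Sum>p\<in>{0..v}\<times>{1..d}. f w p * f x p) = (\<Sum>i=0..v. \<Sum>k=1..d. real (\<xi> i k)
       * ((w i - block_mean v q \<xi> w k) * (x i - block_mean v q \<xi> x k)))"
      by (simp add: sum.cartesian_product case_prod_unfold)
    then show ?thesis by (simp only: information_form)
  qed
  show ?thesis
    using Cauchy_Schwarz_ineq_sum[of "f w" "f x" "{0..v}\<times>{1..d}"]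
    by (simp only: power2_eq_square form)
qed

text \<open>In this form \<open>M\<close> is the weighted Laplacian of the graph on the treatments whose edge weights are the
concurrences; this is the source of the minimum principle below.\<close>

lemma information_map_concurrence:
  "information_map v d q \<xi> w i
     = (\<Sum>m=0..v. real (concurrence d \<xi> i m) * (w i - w m)) / real q"
proof -
  have "w i - block_mean v q \<xi> w k = (\<Sum>m=0..v. real (\<xi> m k) * (w i - w m)) / real q"
    if "k \<in> {1..d}" for k
  proof -
    have "(\<Sum>m=0..v. real (\<xi> m k) * (w i - w m))
        = (\<Sum>m=0..v. real (\<xi> m k)) * w i - (\<Sum>m=0..v. real (\<xi> m k) * w m)"
      by (simp add: sum_distrib_left sum_subtractf algebra_simps)
    with that q show ?thesis by (simp add: block_size block_mean_def field_simps)
  qed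
  then have "information_map v d q \<xi> w i
      = (\<Sum>k=1..d. real (\<xi> i k) * ((\<Sum>m=0..v. real (\<xi> m k) * (w i - w m)) / real q))"
    by (simp add: information_map_def)
  also have "\<dots> = (\<Sum>k=1..d. \<Sum>m=0..v. real (\<xi> i k) * real (\<xi> m k) * (w i - w m)) / real q"
    by (simp add: sum_distrib_left sum_divide_distrib mult.assoc)
  also have "\<dots> = (\<Sum>m=0..v. real (concurrence d \<xi> i m) * (w i - w m)) / real q"
    by (subst sum.swap) (simp add: concurrence_def sum_distrib_right)
  finally show ?thesis .
qed

text \<open>At a test treatment \<open>l\<close> where \<open>w\<close> is minimal, every term of the Laplacian sum is nonpositive, yet the sum
is nonnegative; so the term of the control, which has positive weight, vanishes, and the minimum is attained
at the control as well.\<close>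

lemma information_minimum_principle:
  assumes conn: "\<And>i. i \<in> {1..v} \<Longrightarrow> concurrence d \<xi> 0 i > 0"
    and nonneg: "\<And>i. i \<in> {1..v} \<Longrightarrow> information_map v d q \<xi> w i \<ge> 0"
    and "i \<in> {0..v}"
  shows "w 0 \<le> w i"
proof -
  obtain l where l: "l \<in> {0..v}" and least: "\<And>m. m \<in> {0..v} \<Longrightarrow> w l \<le> w m"
    using ex_is_arg_min_if_finite[of "{0..v}" w] unfolding is_arg_min_def by force
  have "w 0 \<le> w l"
  proof (cases "l = 0")
    case False
    with l have l1: "l \<in> {1..v}" by auto
    have pos: "concurrence d \<xi> l 0 > 0"
      using conn[OF l1] by (simp add: concurrence_def mult.commute)
    have "0 \<le> (\<Sum>m=0..v. real (concurrence d \<xi> l m) * (w l - w m))"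
      using nonneg[OF l1] q by (simp add: information_map_concurrence zero_le_divide_iff)
    also have "\<dots> \<le> real (concurrence d \<xi> l 0) * (w l - w 0)"
    proof -
      have "(\<Sum>m=1..v. real (concurrence d \<xi> l m) * (w l - w m)) \<le> 0"
        using least by (intro sum_nonpos mult_nonneg_nonpos) auto
      then show ?thesis by (simp add: sum_split_control)
    qed
    finally show ?thesis using pos by (simp add: zero_le_mult_iff)
  qed simp
  also have "\<dots> \<le> w i" using least assms(3) by blast
  finally show ?thesis .
qed

text \<open>Among the differences occurring in \<open>M s\<close>, for the indicator \<open>s\<close> of the test treatments, only those
between a test and the control survive. This is \<open>N 1\<^sub>v = (\<mu>\<^sub>0\<^sub>1, \<dots>, \<mu>\<^sub>0\<^sub>v)\<^sup>T / q\<close>, completed by the entry of the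
control.\<close>

lemma information_map_test_indicator:
  "information_map v d q \<xi> (\<lambda>i. if i = 0 then 0 else 1) i
     = (if i = 0 then - (\<Sum>m=1..v. real (concurrence d \<xi> 0 m)) / real q
        else real (concurrence d \<xi> 0 i) / real q)"
proof (cases "i = 0")
  case True
  then show ?thesis
    by (simp add: information_map_concurrence sum_split_control sum_negf)
next
  case False
  have "(\<Sum>m=1..v. real (concurrence d \<xi> i m) * (1 - (if m = 0 then 0 else 1))) = 0"
    by (intro sum.neutral) simp
  with False show ?thesis
    by (simp add: information_map_concurrence sum_split_control concurrence_def mult.commute)
qed

lemma control_concurrence_sum:
  "(\<Sum>m=1..v. concurrence d \<xi> 0 m) = (\<Sum>k=1..d. \<xi> 0 k * (q - \<xi> 0 k))"
proof -
  have "(\<Sum>m=1..v. concurrence d \<xi> 0 m) = (\<Sum>k=1..d. \<xi> 0 k * (\<Sum>m=1..v. \<xi> m k))"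
    unfolding concurrence_def by (subst sum.swap) (simp add: sum_distrib_left)
  also have "\<dots> = (\<Sum>k=1..d. \<xi> 0 k * (q - \<xi> 0 k))"
  proof (intro sum.cong refl arg_cong2[of _ _ _ _ "(*)"])
    fix k assume "k \<in> {1..d}"
    with design have "(\<Sum>m=0..v. \<xi> m k) = q" by (auto simp: block_designs_def)
    then show "(\<Sum>m=1..v. \<xi> m k) = q - \<xi> 0 k" by (simp add: sum_split_control)
  qed
  finally show ?thesis .
qed

end

section \<open>Feasibility as solvability\<close>

lemma treatment_information_mult_vec:
  assumes "x \<in> carrier_vec (v + 1)" and i: "i < v + 1"
  shows "(treatment_information v d q \<xi> *\<^sub>v x) $ i = information_map v d q \<xi> (($) x) i"
proof -
  have set_eq: "{0..<v + 1} = {0..v}" by auto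
  have dim: "dim_row (treatment_information v d q \<xi>) = v + 1"
      "dim_col (treatment_information v d q \<xi>) = v + 1"
    by (simp_all add: treatment_information_def incidence_matrix_def)
  have entry: "treatment_information v d q \<xi> $$ (i, m)
      = (if i = m then real (replications d \<xi> i) else 0)
          - (1 / real q) * (\<Sum>k=0..<d. real (\<xi> i (k + 1)) * real (\<xi> m (k + 1)))"
    if "m < v + 1" for m
    using that i by (simp add: treatment_information_def incidence_matrix_def scalar_prod_def)
  have "(treatment_information v d q \<xi> *\<^sub>v x) $ i
      = (\<Sum>m\<in>{0..<v + 1}. treatment_information v d q \<xi> $$ (i, m) * x $ m)"
    using assms dim by (simp add: scalar_prod_def del: sum.op_ivl_Suc)
  also have "\<dots> = (\<Sum>m=0..v. ((if i = m then real (replications d \<xi> i) else 0)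
          - (1 / real q) * (\<Sum>k=0..<d. real (\<xi> i (k + 1)) * real (\<xi> m (k + 1)))) * x $ m)"
    unfolding set_eq by (intro sum.cong refl) (simp add: entry)
  also have "\<dots> = (\<Sum>m=0..v. (if i = m then real (replications d \<xi> i) else 0) * x $ m)
      - (\<Sum>m=0..v. \<Sum>k=0..<d. real (\<xi> i (k + 1)) * (real (\<xi> m (k + 1)) * x $ m) / real q)"
    by (simp add: left_diff_distrib sum_subtractf sum_distrib_left sum_distrib_right
        sum_divide_distrib mult.assoc)
  also have "(\<Sum>m=0..v. (if i = m then real (replications d \<xi> i) else 0) * x $ m)
      = real (replications d \<xi> i) * x $ i"
  proof -
    have "(\<Sum>m=0..v. (if i = m then real (replications d \<xi> i) else 0) * x $ m)
        = (\<Sum>m=0..v. if i = m then real (replications d \<xi> i) * x $ m else 0)"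
      by (intro sum.cong) auto
    then show ?thesis using i by simp
  qed
  also have "(\<Sum>m=0..v. \<Sum>k=0..<d. real (\<xi> i (k + 1)) * (real (\<xi> m (k + 1)) * x $ m) / real q)
      = (\<Sum>k=0..<d. real (\<xi> i (k + 1)) * block_mean v q \<xi> (($) x) (k + 1))"
    by (subst sum.swap) (simp add: block_mean_def sum_distrib_left sum_divide_distrib)
  also have "\<dots> = (\<Sum>k=1..d. real (\<xi> i k) * block_mean v q \<xi> (($) x) k)"
    by (rule sum.reindex_bij_witness[of _ "\<lambda>k. k - 1" "\<lambda>k. k + 1"]) auto
  finally show ?thesis
    by (simp add: information_map_def replications_def right_diff_distrib sum_subtractf
        sum_distrib_right)
qed

definition comparison_vector where
  "comparison_vector l i = (if i = l then 1 else 0) - (if i = 0 then 1 else 0 :: real)"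
  for l i :: nat

lemma information_map_cong:
  "(\<And>i. i \<in> {0..v} \<Longrightarrow> w i = x i) \<Longrightarrow> i \<in> {0..v}
     \<Longrightarrow> information_map v d q \<xi> w i = information_map v d q \<xi> x i"
  by (simp add: information_map_def block_mean_def)

text \<open>The columns of \<open>Q\<close> are the comparison vectors \<open>e\<^sub>l - e\<^sub>0\<close>, and a column space contains that of \<open>Q\<close> as soon
as it contains these.\<close>

lemma feasible_iff_comparisons:
  "feasible v d q \<xi>
     \<longleftrightarrow> (\<forall>l\<in>{1..v}. \<exists>w. \<forall>i\<in>{0..v}. information_map v d q \<xi> w i = comparison_vector l i)"
proof -
  let ?K = "control_contrasts v" and ?M = "treatment_information v d q \<xi>"
  have K: "?K \<in> carrier_mat (v + 1) v" by (simp add: control_contrasts_def)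
  have M: "?M \<in> carrier_mat (v + 1) (v + 1)"
    by (simp add: treatment_information_def incidence_matrix_def minus_mat_def)
  have K_mult: "(?K *\<^sub>v x) $ i = (\<Sum>l=1..v. x $ (l - 1) * comparison_vector l i)"
    if "x \<in> carrier_vec v" "i < v + 1" for x :: "real vec" and i
  proof -
    have "(?K *\<^sub>v x) $ i
        = (\<Sum>j=0..<v. (if i = 0 then - 1 else if i = j + 1 then 1 else 0) * x $ j)"
      using that by (auto simp: control_contrasts_def scalar_prod_def)
    also have "\<dots> = (\<Sum>l=1..v. x $ (l - 1) * comparison_vector l i)"
      by (rule sum.reindex_bij_witness[of _ "\<lambda>l. l - 1" "\<lambda>j. j + 1"])
        (auto simp: comparison_vector_def)
    finally show ?thesis .
  qed
  have col_K: "vec_space.col_space (v + 1) ?K = {?K *\<^sub>v x |x. x \<in> carrier_vec v}"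
    using vec_space.col_space_eq[OF K] K by auto
  have col_M: "vec_space.col_space (v + 1) ?M = {?M *\<^sub>v x |x. x \<in> carrier_vec (v + 1)}"
    using vec_space.col_space_eq[OF M] M by auto
  show ?thesis
  proof
    assume feas: "feasible v d q \<xi>"
    show "\<forall>l\<in>{1..v}. \<exists>w. \<forall>i\<in>{0..v}. information_map v d q \<xi> w i = comparison_vector l i"
    proof
      fix l assume l: "l \<in> {1..v}"
      have "?K *\<^sub>v unit_vec v (l - 1) \<in> vec_space.col_space (v + 1) ?K"
        unfolding col_K by auto
      then have "?K *\<^sub>v unit_vec v (l - 1) \<in> vec_space.col_space (v + 1) ?M"
        using feas by (auto simp: feasible_def)
      then obtain x where x: "x \<in> carrier_vec (v + 1)" "?K *\<^sub>v unit_vec v (l - 1) = ?M *\<^sub>v x"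
        unfolding col_M by auto
      have "information_map v d q \<xi> (($) x) i = comparison_vector l i" if i: "i \<in> {0..v}" for i
      proof -
        have "information_map v d q \<xi> (($) x) i = (?K *\<^sub>v unit_vec v (l - 1)) $ i"
          using treatment_information_mult_vec[OF x(1), of i] i x(2) by simp
        also have "\<dots> = (\<Sum>m=1..v. unit_vec v (l - 1) $ (m - 1) * comparison_vector m i)"
          using i by (intro K_mult) auto
        also have "\<dots> = (\<Sum>m=1..v. if m = l then comparison_vector m i else 0)"
          using l by (intro sum.cong) auto
        also have "\<dots> = comparison_vector l i" using l by simp
        finally show ?thesis .
      qed
      then show "\<exists>w. \<forall>i\<in>{0..v}. information_map v d q \<xi> w i = comparison_vector l i" by blast
    qed
  next
    assume "\<forall>l\<in>{1..v}. \<exists>w. \<forall>i\<in>{0..v}. information_map v d q \<xi> w i = comparison_vector l i"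
    then obtain w where w: "\<And>l i. l \<in> {1..v} \<Longrightarrow> i \<in> {0..v}
        \<Longrightarrow> information_map v d q \<xi> (w l) i = comparison_vector l i"
      by metis
    have "?K *\<^sub>v x \<in> vec_space.col_space (v + 1) ?M" if x: "x \<in> carrier_vec v" for x
    proof -
      define z where "z = vec (v + 1) (\<lambda>i. \<Sum>l=1..v. x $ (l - 1) * w l i)"
      have z: "z \<in> carrier_vec (v + 1)" by (simp add: z_def)
      have "?K *\<^sub>v x = ?M *\<^sub>v z"
      proof (rule eq_vecI)
        show "dim_vec (?K *\<^sub>v x) = dim_vec (?M *\<^sub>v z)" using K M by simp
        fix i assume "i < dim_vec (?M *\<^sub>v z)"
        then have i: "i < v + 1" using M by simp
        have "(?M *\<^sub>v z) $ i = information_map v d q \<xi> (($) z) i"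
          by (rule treatment_information_mult_vec[OF z i])
        also have "\<dots> = information_map v d q \<xi> (\<lambda>i. \<Sum>l=1..v. x $ (l - 1) * w l i) i"
          using i by (intro information_map_cong) (auto simp: z_def)
        also have "\<dots> = (\<Sum>l=1..v. x $ (l - 1) * comparison_vector l i)"
          using i w by (simp add: information_map_linear)
        finally show "(?K *\<^sub>v x) $ i = (?M *\<^sub>v z) $ i" using K_mult[OF x i] by simp
      qed
      with z show ?thesis unfolding col_M by auto
    qed
    then show "feasible v d q \<xi>" unfolding feasible_def col_K by auto
  qed
qed

section \<open>Least squares estimators\<close>

lemma exact_design_trial_sum:
  fixes f :: "nat \<Rightarrow> nat \<Rightarrow> real"
  assumes "realizes v d q \<xi> t b"
  shows "(\<Sum>j=1..d*q. f (t j) (b j)) = (\<Sum>i=0..v. \<Sum>k=1..d. real (\<xi> i k) * f i k)"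
proof -
  have "(\<Sum>j=1..d*q. f (t j) (b j))
      = (\<Sum>p\<in>{0..v}\<times>{1..d}. \<Sum>j\<in>{j\<in>{1..d*q}. (t j, b j) = p}. f (t j) (b j))"
    using assms by (intro sum.group[symmetric]) (auto simp: realizes_def)
  also have "\<dots> = (\<Sum>p\<in>{0..v}\<times>{1..d}. real (\<xi> (fst p) (snd p)) * f (fst p) (snd p))"
  proof (intro sum.cong refl)
    fix p assume p: "p \<in> {0..v}\<times>{1..d}"
    have "(\<Sum>j\<in>{j\<in>{1..d*q}. (t j, b j) = p}. f (t j) (b j))
        = (\<Sum>j\<in>{j\<in>{1..d*q}. t j = fst p \<and> b j = snd p}. f (fst p) (snd p))"
      by (intro sum.cong) auto
    then show "(\<Sum>j\<in>{j\<in>{1..d*q}. (t j, b j) = p}. f (t j) (b j))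
        = real (\<xi> (fst p) (snd p)) * f (fst p) (snd p)"
      using assms p by (auto simp: realizes_def)
  qed
  finally show ?thesis by (simp add: sum.cartesian_product case_prod_unfold)
qed

text \<open>Fitted treatment effects are defined through a choice of minimizer and carry information only once
a minimizer is known to exist. The columns used here are the indicators of the trials with
a given treatment (left summand) and of those in a given block (right summand); the general mean
lies in their span and is set to zero.\<close>

lemma least_squares_minimizer_exists:
  assumes t: "\<And>j. j \<in> {1..n} \<Longrightarrow> t j \<in> {0..v}" and b: "\<And>j. j \<in> {1..n} \<Longrightarrow> b j \<in> {1..d}"
  shows "\<exists>p. \<forall>p'. residual_sum_of_squares n t b y p \<le> residual_sum_of_squares n t b y p'"
proof -
  define A where "A k j = (case k of Inl i \<Rightarrow> if t j = i then 1 else 0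
    | Inr m \<Rightarrow> if b j = m then 1 else (0::real))" for k :: "nat + nat" and j
  let ?I = "{0..v} <+> {1..d}"
  obtain c where c: "\<And>i. i \<in> ?I \<Longrightarrow>
      (\<Sum>j\<in>{1..n}. (y j - (\<Sum>k\<in>?I. c k * A k j)) * A i j) = 0"
    using normal_equations_solvable[of ?I y A "{1..n}"] by auto
  define r where "r j = y j - (c (Inl (t j)) + c (Inr (b j)))" for j
  have fit: "(\<Sum>k\<in>?I. c k * A k j) = c (Inl (t j)) + c (Inr (b j))" if "j \<in> {1..n}" for j
  proof -
    have "(\<Sum>i=0..v. c (Inl i) * A (Inl i) j) = (\<Sum>i=0..v. if t j = i then c (Inl i) else 0)"
      by (intro sum.cong) (auto simp: A_def)
    moreover have "(\<Sum>m=1..d. c (Inr m) * A (Inr m) j) = (\<Sum>m=1..d. if b j = m then c (Inr m) else 0)"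
      by (intro sum.cong) (auto simp: A_def)
    ultimately show ?thesis using t[OF that] b[OF that] by (simp add: sum.Plus)
  qed
  have orth: "(\<Sum>j=1..n. r j * A i j) = 0" if "i \<in> ?I" for i
    using c[OF that] fit by (simp add: r_def)
  have orth_t: "(\<Sum>j=1..n. r j * \<alpha> (t j)) = 0" for \<alpha>
  proof -
    have "(\<Sum>j=1..n. r j * \<alpha> (t j)) = (\<Sum>j=1..n. \<Sum>i=0..v. \<alpha> i * (r j * A (Inl i) j))"
    proof (intro sum.cong refl)
      fix j assume j: "j \<in> {1..n}"
      have "(\<Sum>i=0..v. \<alpha> i * (r j * A (Inl i) j)) = (\<Sum>i=0..v. if t j = i then r j * \<alpha> i else 0)"
        by (intro sum.cong) (auto simp: A_def)
      then show "r j * \<alpha> (t j) = (\<Sum>i=0..v. \<alpha> i * (r j * A (Inl i) j))"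
        using t[OF j] by simp
    qed
    also have "\<dots> = (\<Sum>i=0..v. \<alpha> i * (\<Sum>j=1..n. r j * A (Inl i) j))"
      by (subst sum.swap) (simp add: sum_distrib_left)
    also have "\<dots> = 0" using orth by (intro sum.neutral) auto
    finally show ?thesis .
  qed
  have orth_b: "(\<Sum>j=1..n. r j * \<beta> (b j)) = 0" for \<beta>
  proof -
    have "(\<Sum>j=1..n. r j * \<beta> (b j)) = (\<Sum>j=1..n. \<Sum>m=1..d. \<beta> m * (r j * A (Inr m) j))"
    proof (intro sum.cong refl)
      fix j assume j: "j \<in> {1..n}"
      have "(\<Sum>m=1..d. \<beta> m * (r j * A (Inr m) j)) = (\<Sum>m=1..d. if b j = m then r j * \<beta> m else 0)"
        by (intro sum.cong) (auto simp: A_def)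
      then show "r j * \<beta> (b j) = (\<Sum>m=1..d. \<beta> m * (r j * A (Inr m) j))"
        using b[OF j] by simp
    qed
    also have "\<dots> = (\<Sum>m=1..d. \<beta> m * (\<Sum>j=1..n. r j * A (Inr m) j))"
      by (subst sum.swap) (simp add: sum_distrib_left)
    also have "\<dots> = 0" using orth by (intro sum.neutral) auto
    finally show ?thesis .
  qed
  have "residual_sum_of_squares n t b y (0, c \<circ> Inl, c \<circ> Inr)
      \<le> residual_sum_of_squares n t b y p'" for p'
  proof -
    obtain m \<alpha> \<beta> where p': "p' = (m, \<alpha>, \<beta>)" by (cases p') auto
    define z where "z j = (m + \<alpha> (t j) - c (Inl (t j))) + (\<beta> (b j) - c (Inr (b j)))" for j
    have "(\<Sum>j=1..n. r j * z j) = 0"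
      using orth_t[of "\<lambda>i. m + \<alpha> i - c (Inl i)"] orth_b[of "\<lambda>k. \<beta> k - c (Inr k)"]
      by (simp only: z_def distrib_left sum.distrib)
    moreover have "(\<Sum>j=1..n. (r j - z j)\<^sup>2)
        = (\<Sum>j=1..n. (r j)\<^sup>2) - 2 * (\<Sum>j=1..n. r j * z j) + (\<Sum>j=1..n. (z j)\<^sup>2)"
      by (simp add: power2_diff sum.distrib sum_subtractf sum_distrib_left mult.assoc)
    moreover have "(\<Sum>j=1..n. (z j)\<^sup>2) \<ge> 0" by (intro sum_nonneg) simp
    ultimately have "(\<Sum>j=1..n. (r j)\<^sup>2) \<le> (\<Sum>j=1..n. (r j - z j)\<^sup>2)" by linarith
    moreover have "residual_sum_of_squares n t b y (0, c \<circ> Inl, c \<circ> Inr) = (\<Sum>j=1..n. (r j)\<^sup>2)"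
      by (simp add: residual_sum_of_squares_def r_def)
    moreover have "residual_sum_of_squares n t b y p' = (\<Sum>j=1..n. (r j - z j)\<^sup>2)"
      unfolding residual_sum_of_squares_def p' prod.case
      by (intro sum.cong refl) (simp add: r_def z_def algebra_simps)
    ultimately show ?thesis by simp
  qed
  then show ?thesis by blast
qed

text \<open>The residual sum of squares along the line through the minimizer in direction \<open>(0, w, x)\<close> is
a parabola with its minimum at the origin, so its linear coefficient vanishes.\<close>

lemma least_squares_residual_orthogonal:
  assumes least: "\<And>p'. residual_sum_of_squares n t b y (m, \<alpha>, \<beta>) \<le> residual_sum_of_squares n t b y p'"
  shows "(\<Sum>j=1..n. (y j - (m + \<alpha> (t j) + \<beta> (b j))) * (w (t j) + x (b j))) = 0"
proof -
  define r where "r j = y j - (m + \<alpha> (t j) + \<beta> (b j))" for j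
  define h where "h j = w (t j) + x (b j)" for j
  define R where "R = (\<Sum>j=1..n. r j * h j)"
  define Z where "Z = (\<Sum>j=1..n. (h j)\<^sup>2)"
  have Z: "Z \<ge> 0" unfolding Z_def by (intro sum_nonneg) simp
  \<comment> \<open>The vertex of the parabola is at \<open>R / Z\<close>; the denominator \<open>Z + 1\<close> gives a shorter step, which would still
    decrease the sum of squares if \<open>R \<noteq> 0\<close>, and it avoids the case \<open>Z = 0\<close>.\<close>
  define s where "s = R / (Z + 1)"
  have "(\<Sum>j=1..n. (r j)\<^sup>2) \<le> (\<Sum>j=1..n. (r j - s * h j)\<^sup>2)"
  proof -
    have "residual_sum_of_squares n t b y (m, \<alpha>, \<beta>) = (\<Sum>j=1..n. (r j)\<^sup>2)"
      by (simp add: residual_sum_of_squares_def r_def)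
    moreover have "residual_sum_of_squares n t b y
        (m, \<lambda>i. \<alpha> i + s * w i, \<lambda>k. \<beta> k + s * x k) = (\<Sum>j=1..n. (r j - s * h j)\<^sup>2)"
      unfolding residual_sum_of_squares_def prod.case
      by (intro sum.cong refl) (simp add: r_def h_def algebra_simps)
    ultimately show ?thesis
      using least[of "(m, \<lambda>i. \<alpha> i + s * w i, \<lambda>k. \<beta> k + s * x k)"] by simp
  qed
  also have "\<dots> = (\<Sum>j=1..n. (r j)\<^sup>2 - 2 * s * (r j * h j) + s\<^sup>2 * (h j)\<^sup>2)"
    by (intro sum.cong) (simp_all add: power2_diff power_mult_distrib)
  also have "\<dots> = (\<Sum>j=1..n. (r j)\<^sup>2) - 2 * s * R + s\<^sup>2 * Z"
    by (simp add: R_def Z_def sum.distrib sum_subtractf sum_distrib_left)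
  finally have "2 * s * R \<le> s\<^sup>2 * Z" by simp
  moreover have "R = s * (Z + 1)" using Z by (simp add: s_def)
  ultimately have "s\<^sup>2 * (Z + 2) \<le> 0" by (simp add: algebra_simps power2_eq_square)
  moreover have "s\<^sup>2 * (Z + 2) \<ge> s\<^sup>2" using Z mult_left_mono[of 1 "Z + 2" "s\<^sup>2"] by simp
  ultimately have "s = 0" by (smt (verit) zero_less_power2)
  with \<open>R = s * (Z + 1)\<close> show ?thesis by (simp add: R_def r_def h_def)
qed

text \<open>The coefficients \<open>c j = w (t j) - block mean\<close> lie in the column space of the design, so the residual of any
fit is orthogonal to them and \<open>y\<close> may be replaced by its fitted values. They also sum to zero in every
block, which removes the general mean and the block effects, and what remains of the fit is \<open>(M w)\<^sup>T \<alpha>\<close> for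
the fitted treatment effects \<open>\<alpha>\<close>. In particular the value does not depend on the minimizer chosen.\<close>

lemma estimable_contrast_estimator:
  assumes design: "\<xi> \<in> block_designs v d q" and q: "q \<ge> 1" and layout: "realizes v d q \<xi> t b"
    and a: "\<And>i. i \<in> {0..v} \<Longrightarrow> information_map v d q \<xi> w i = a i"
  shows "(\<Sum>i=0..v. a i * fitted_treatment_effects (d * q) t b y i)
    = (\<Sum>j=1..d*q. (w (t j) - block_mean v q \<xi> w (b j)) * y j)"
proof -
  let ?rss = "residual_sum_of_squares (d * q) t b y"
  have "\<exists>p. is_arg_min ?rss (\<lambda>_. True) p"
  proof -
    have "t j \<in> {0..v}" "b j \<in> {1..d}" if "j \<in> {1..d*q}" for j
      using layout that by (auto simp: realizes_def)
    from least_squares_minimizer_exists[where n = "d * q" and y = y, OF this]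
    show ?thesis by (auto simp: is_arg_min_def not_less)
  qed
  then have "is_arg_min ?rss (\<lambda>_. True) (arg_min ?rss (\<lambda>_. True))"
    unfolding arg_min_def by (rule someI_ex)
  moreover obtain m \<alpha> \<beta> where fit: "arg_min ?rss (\<lambda>_. True) = (m, \<alpha>, \<beta>)"
    by (cases "arg_min ?rss (\<lambda>_. True)") auto
  ultimately have least: "\<And>p'. ?rss (m, \<alpha>, \<beta>) \<le> ?rss p'"
    by (auto simp: is_arg_min_def not_less)
  define c where "c j = w (t j) - block_mean v q \<xi> w (b j)" for j
  have "(\<Sum>j=1..d*q. (y j - (m + \<alpha> (t j) + \<beta> (b j))) * c j) = 0"
    using least_squares_residual_orthogonal[OF least, of w "\<lambda>k. - block_mean v q \<xi> w k"]
    by (simp add: c_def)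
  then have "(\<Sum>j=1..d*q. c j * y j) = (\<Sum>j=1..d*q. c j * (m + \<alpha> (t j) + \<beta> (b j)))"
  proof -
    assume "(\<Sum>j=1..d*q. (y j - (m + \<alpha> (t j) + \<beta> (b j))) * c j) = 0"
    moreover have "(\<Sum>j=1..d*q. c j * y j) - (\<Sum>j=1..d*q. c j * (m + \<alpha> (t j) + \<beta> (b j)))
        = (\<Sum>j=1..d*q. (y j - (m + \<alpha> (t j) + \<beta> (b j))) * c j)"
      unfolding sum_subtractf[symmetric] by (intro sum.cong refl) (simp add: algebra_simps)
    ultimately show ?thesis by simp
  qed
  also have "\<dots> = (\<Sum>i=0..v. \<Sum>k=1..d. real (\<xi> i k)
      * ((w i - block_mean v q \<xi> w k) * (m + \<alpha> i + \<beta> k)))"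
    unfolding c_def
    by (rule exact_design_trial_sum[OF layout, of "\<lambda>i k. (w i - block_mean v q \<xi> w k) * (m + \<alpha> i + \<beta> k)"])
  also have "\<dots> = (\<Sum>i=0..v. \<Sum>k=1..d. \<alpha> i * (real (\<xi> i k) * (w i - block_mean v q \<xi> w k)))
      + (\<Sum>i=0..v. \<Sum>k=1..d. (m + \<beta> k) * (real (\<xi> i k) * (w i - block_mean v q \<xi> w k)))"
    unfolding sum.distrib[symmetric] by (intro sum.cong refl) (simp add: algebra_simps)
  also have "(\<Sum>i=0..v. \<Sum>k=1..d. (m + \<beta> k) * (real (\<xi> i k) * (w i - block_mean v q \<xi> w k))) = 0"
  proof -
    have "(\<Sum>i=0..v. \<Sum>k=1..d. (m + \<beta> k) * (real (\<xi> i k) * (w i - block_mean v q \<xi> w k)))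
        = (\<Sum>k=1..d. (m + \<beta> k) * (\<Sum>i=0..v. real (\<xi> i k) * (w i - block_mean v q \<xi> w k)))"
      by (subst sum.swap) (simp add: sum_distrib_left)
    then show ?thesis using block_deviations_sum[OF design q] by (simp add: sum.neutral)
  qed
  also have "(\<Sum>i=0..v. \<Sum>k=1..d. \<alpha> i * (real (\<xi> i k) * (w i - block_mean v q \<xi> w k)))
      = (\<Sum>i=0..v. a i * \<alpha> i)"
    unfolding sum_distrib_left[symmetric] information_map_def[symmetric]
    using a by (simp add: mult.commute)
  finally show ?thesis by (simp add: fitted_treatment_effects_def fit c_def)
qed

lemma covariance_linear_combinations:
  assumes "prob_space P" and err: "uncorrelated_errors P n \<sigma> \<epsilon>"
  shows "covariance P (\<lambda>\<omega>. x + (\<Sum>j=1..n. c j * \<epsilon> j \<omega>)) (\<lambda>\<omega>. y + (\<Sum>j=1..n. g j * \<epsilon> j \<omega>))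
    = \<sigma>\<^sup>2 * (\<Sum>j=1..n. c j * g j)"
proof -
  interpret prob_space P by fact
  have meas: "\<epsilon> j \<in> borel_measurable P" and sq: "integrable P (\<lambda>\<omega>. (\<epsilon> j \<omega>)\<^sup>2)"
    and mean: "(LINT \<omega>|P. \<epsilon> j \<omega>) = 0" and var: "variance (\<epsilon> j) = \<sigma>\<^sup>2" if "j \<in> {1..n}" for j
    using err that unfolding uncorrelated_errors_def by blast+
  have int: "integrable P (\<epsilon> j)" if "j \<in> {1..n}" for j
    using square_integrable_imp_integrable[OF meas[OF that] sq[OF that]] .
  have int2: "integrable P (\<lambda>\<omega>. \<epsilon> j \<omega> * \<epsilon> l \<omega>)" if j: "j \<in> {1..n}" and l: "l \<in> {1..n}" for j l
  proof (rule Bochner_Integration.integrable_bound)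
    show "integrable P (\<lambda>\<omega>. (\<epsilon> j \<omega>)\<^sup>2 + (\<epsilon> l \<omega>)\<^sup>2)" using sq j l by simp
    show "(\<lambda>\<omega>. \<epsilon> j \<omega> * \<epsilon> l \<omega>) \<in> borel_measurable P" using meas j l by measurable
    have "\<bar>\<epsilon> j \<omega> * \<epsilon> l \<omega>\<bar> \<le> (\<epsilon> j \<omega>)\<^sup>2 + (\<epsilon> l \<omega>)\<^sup>2" for \<omega>
      using sum_squares_bound[of "\<bar>\<epsilon> j \<omega>\<bar>" "\<bar>\<epsilon> l \<omega>\<bar>"] abs_ge_zero[of "\<epsilon> j \<omega> * \<epsilon> l \<omega>"]
      unfolding abs_mult power2_abs by linarith
    then show "AE \<omega> in P. norm (\<epsilon> j \<omega> * \<epsilon> l \<omega>) \<le> norm ((\<epsilon> j \<omega>)\<^sup>2 + (\<epsilon> l \<omega>)\<^sup>2)" by simp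
  qed
  have prod: "(LINT \<omega>|P. \<epsilon> j \<omega> * \<epsilon> l \<omega>) = (if j = l then \<sigma>\<^sup>2 else 0)"
    if j: "j \<in> {1..n}" and l: "l \<in> {1..n}" for j l
  proof (cases "j = l")
    case True
    then show ?thesis using var[OF j] mean[OF j] by (simp add: power2_eq_square)
  next
    case False
    then have "covariance P (\<epsilon> j) (\<epsilon> l) = 0"
      using err j l by (auto simp: uncorrelated_errors_def)
    with False show ?thesis using mean[OF j] mean[OF l] by (simp add: covariance_def)
  qed
  have expect: "(LINT \<omega>|P. z + (\<Sum>j=1..n. f j * \<epsilon> j \<omega>)) = z" for z and f :: "nat \<Rightarrow> real"
  proof -
    have "(LINT \<omega>|P. z + (\<Sum>j=1..n. f j * \<epsilon> j \<omega>)) = z + (\<Sum>j=1..n. f j * (LINT \<omega>|P. \<epsilon> j \<omega>))"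
      using int by (subst Bochner_Integration.integral_add)
        (auto simp: prob_space Bochner_Integration.integral_sum)
    then show ?thesis using mean by simp
  qed
  have "covariance P (\<lambda>\<omega>. x + (\<Sum>j=1..n. c j * \<epsilon> j \<omega>)) (\<lambda>\<omega>. y + (\<Sum>j=1..n. g j * \<epsilon> j \<omega>))
      = (LINT \<omega>|P. (\<Sum>j=1..n. c j * \<epsilon> j \<omega>) * (\<Sum>l=1..n. g l * \<epsilon> l \<omega>))"
    unfolding covariance_def expect by simp
  also have "\<dots> = (LINT \<omega>|P. (\<Sum>j=1..n. \<Sum>l=1..n. (c j * g l) * (\<epsilon> j \<omega> * \<epsilon> l \<omega>)))"
    by (simp only: sum_product mult_ac)
  also have "\<dots> = (\<Sum>j=1..n. \<Sum>l=1..n. (c j * g l) * (LINT \<omega>|P. \<epsilon> j \<omega> * \<epsilon> l \<omega>))"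
  proof -
    have summand: "integrable P (\<lambda>\<omega>. (c j * g l) * (\<epsilon> j \<omega> * \<epsilon> l \<omega>))" if "j \<in> {1..n}" "l \<in> {1..n}" for j l
      using int2[OF that] by simp
    then have "(LINT \<omega>|P. (\<Sum>j=1..n. \<Sum>l=1..n. (c j * g l) * (\<epsilon> j \<omega> * \<epsilon> l \<omega>)))
        = (\<Sum>j=1..n. LINT \<omega>|P. (\<Sum>l=1..n. (c j * g l) * (\<epsilon> j \<omega> * \<epsilon> l \<omega>)))"
      by (intro Bochner_Integration.integral_sum) (rule Bochner_Integration.integrable_sum)
    also have "\<dots> = (\<Sum>j=1..n. \<Sum>l=1..n. LINT \<omega>|P. (c j * g l) * (\<epsilon> j \<omega> * \<epsilon> l \<omega>))"
      using summand by (intro sum.cong refl Bochner_Integration.integral_sum)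
    finally show ?thesis by simp
  qed
  also have "\<dots> = (\<Sum>j=1..n. \<Sum>l=1..n. if j = l then \<sigma>\<^sup>2 * (c j * g l) else 0)"
    by (intro sum.cong refl) (simp add: prod)
  also have "\<dots> = \<sigma>\<^sup>2 * (\<Sum>j=1..n. c j * g j)"
    by (simp add: sum_distrib_left)
  finally show ?thesis .
qed

text \<open>The estimators are \<open>\<Sum>\<^sub>j c\<^sub>j Y\<^sub>j\<close> with the block-centred values \<open>c\<close> of \<open>w\<close> and of \<open>x\<close>, whose inner product over the
trials is \<open>w\<^sup>T M x\<close> by \<open>information_form\<close>.\<close>

lemma covariance_estimable_contrasts:
  fixes \<mu> :: real and \<tau> \<theta> :: "nat \<Rightarrow> real"
  assumes "prob_space P" and err: "uncorrelated_errors P (d * q) \<sigma> \<epsilon>"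
    and design: "\<xi> \<in> block_designs v d q" and q: "q \<ge> 1" and layout: "realizes v d q \<xi> t b"
    and a: "\<And>i. i \<in> {0..v} \<Longrightarrow> information_map v d q \<xi> w i = a i"
    and a': "\<And>i. i \<in> {0..v} \<Longrightarrow> information_map v d q \<xi> x i = a' i"
  defines "fit \<equiv> \<lambda>\<omega>. fitted_treatment_effects (d * q) t b (\<lambda>j. observation t b \<mu> \<tau> \<theta> \<epsilon> j \<omega>)"
  shows "covariance P (\<lambda>\<omega>. \<Sum>i=0..v. a i * fit \<omega> i) (\<lambda>\<omega>. \<Sum>i=0..v. a' i * fit \<omega> i)
    = \<sigma>\<^sup>2 * (\<Sum>i=0..v. w i * a' i)"
proof -
  define c where "c w j = w (t j) - block_mean v q \<xi> w (b j)" for w j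
  define e where "e j = \<mu> + \<tau> (t j) + \<theta> (b j)" for j
  have est: "(\<Sum>i=0..v. f i * fit \<omega> i)
      = (\<Sum>j=1..d*q. c u j * e j) + (\<Sum>j=1..d*q. c u j * \<epsilon> j \<omega>)"
    if "\<And>i. i \<in> {0..v} \<Longrightarrow> information_map v d q \<xi> u i = f i" for u f \<omega>
  proof -
    have "(\<Sum>i=0..v. f i * fit \<omega> i) = (\<Sum>j=1..d*q. c u j * observation t b \<mu> \<tau> \<theta> \<epsilon> j \<omega>)"
      unfolding fit_def c_def by (rule estimable_contrast_estimator[OF design q layout that])
    then show ?thesis
      by (simp only: e_def observation_def distrib_left[of "c u _" _ "\<epsilon> _ _"] sum.distrib)
  qed
  have "(\<Sum>j=1..d*q. c w j * c x j) = (\<Sum>i=0..v. \<Sum>k=1..d. real (\<xi> i k)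
       * ((w i - block_mean v q \<xi> w k) * (x i - block_mean v q \<xi> x k)))"
    unfolding c_def by (rule exact_design_trial_sum[OF layout,
          of "\<lambda>i k. (w i - block_mean v q \<xi> w k) * (x i - block_mean v q \<xi> x k)"])
  also have "\<dots> = (\<Sum>i=0..v. w i * information_map v d q \<xi> x i)"
    by (simp only: information_form[OF design q] information_map_symmetric[OF design q, of x w])
  also have "\<dots> = (\<Sum>i=0..v. w i * a' i)" using a' by simp
  finally show ?thesis
    by (simp only: est[of w a, OF a] est[of x a', OF a'] covariance_linear_combinations[OF assms(1) err])
qed


section \<open>The two criteria\<close>

text \<open>The coefficients, for treatments \<open>0, \<dots>, v\<close>, of the mean test effect minus the control effect.\<close>

definition average_vector where
  "average_vector v i = (if i = 0 then -1 else 1 / real v :: real)" for i :: nat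

lemma sum_comparison_vector:
  assumes "l \<in> {1..v}"
  shows "(\<Sum>i=0..v. comparison_vector l i * f i) = f l - f 0"
proof -
  have "(\<Sum>i=1..v. comparison_vector l i * f i) = (\<Sum>i=1..v. if i = l then f i else 0)"
    by (intro sum.cong) (auto simp: comparison_vector_def)
  with assms show ?thesis
    by (simp add: sum_split_control comparison_vector_def)
qed

lemma sum_average_vector:
  "(\<Sum>i=0..v. average_vector v i * f i) = (\<Sum>i=1..v. f i) / real v - f 0"
  by (simp add: sum_split_control average_vector_def sum_divide_distrib)

lemma average_vector_mean_comparison:
  assumes "v \<ge> 1" "i \<in> {0..v}"
  shows "(\<Sum>l=1..v. 1 / real v * comparison_vector l i) = average_vector v i"
proof (cases "i = 0")
  case True
  have "(\<Sum>l=1..v. 1 / real v * comparison_vector l i) = (\<Sum>l=1..v. - (1 / real v))"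
    using True by (intro sum.cong) (auto simp: comparison_vector_def)
  with True assms show ?thesis by (simp add: average_vector_def)
next
  case False
  have "(\<Sum>l=1..v. 1 / real v * comparison_vector l i) = (\<Sum>l=1..v. if l = i then 1 / real v else 0)"
    using False by (intro sum.cong) (auto simp: comparison_vector_def)
  with False assms show ?thesis by (simp add: average_vector_def)
qed

text \<open>Here \<open>C\<close> is the covariance matrix \<open>\<sigma>\<^sup>2 N\<^sup>-\<^sup>1\<close>, since \<open>w\<^sub>i\<^sup>T (e\<^sub>l - e\<^sub>0) = w\<^sub>i(l) - w\<^sub>i(0)\<close>. The last equation compares the
two criteria: the average contrast is the mean of the \<open>v\<close> comparisons, so \<open>v\<^sup>2\<close> times its
variance is the sum of all entries of \<open>C\<close>, which is the second criterion without the absolute values.\<close>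

lemma criteria_of_feasible_design:
  assumes "prob_space P" and err: "uncorrelated_errors P (d * q) \<sigma> \<epsilon>"
    and design: "\<xi> \<in> block_designs v d q" and q: "q \<ge> 1" and layout: "realizes v d q \<xi> t b"
    and feas: "feasible v d q \<xi>" and v: "v \<ge> 1"
    and comparisons: "\<forall>l\<in>{1..v}. \<forall>i\<in>{0..v}. information_map v d q \<xi> (w l) i = comparison_vector l i"
  defines "u \<equiv> \<lambda>i. \<Sum>l=1..v. 1 / real v * w l i"
    and "C \<equiv> \<lambda>i l. \<sigma>\<^sup>2 * (w i l - w i 0)"
  shows "\<forall>i\<in>{0..v}. information_map v d q \<xi> u i = average_vector v i"
    and "average_criterion P v d q \<mu> \<tau> \<theta> \<epsilon> \<xi> t b = ereal (\<sigma>\<^sup>2 * (\<Sum>i=0..v. u i * average_vector v i))"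
    and "absolute_covariance_criterion P v d q \<mu> \<tau> \<theta> \<epsilon> \<xi> t b
      = ereal ((\<Sum>i=1..v. C i i) + (\<Sum>i=1..v. \<Sum>l\<in>{1..v} - {i}. \<bar>C i l\<bar>))"
    and "(real v)\<^sup>2 * (\<sigma>\<^sup>2 * (\<Sum>i=0..v. u i * average_vector v i))
      = (\<Sum>i=1..v. C i i) + (\<Sum>i=1..v. \<Sum>l\<in>{1..v} - {i}. C i l)"
proof -
  let ?Y = "observation t b \<mu> \<tau> \<theta> \<epsilon>"
  let ?fit = "\<lambda>\<omega>. fitted_treatment_effects (d * q) t b (\<lambda>j. ?Y j \<omega>)"
  have var: "(LINT \<omega>|P. (X \<omega> - (LINT x|P. X x))\<^sup>2) = covariance P X X" for X :: "'a \<Rightarrow> real"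
    by (simp add: covariance_def power2_eq_square)
  have w: "information_map v d q \<xi> (w l) i = comparison_vector l i" if "l \<in> {1..v}" "i \<in> {0..v}" for l i
    using comparisons that by blast
  have u: "information_map v d q \<xi> u i = average_vector v i" if "i \<in> {0..v}" for i
  proof -
    have "information_map v d q \<xi> u i = (\<Sum>l=1..v. 1 / real v * information_map v d q \<xi> (w l) i)"
      unfolding u_def by (rule information_map_linear)
    also have "\<dots> = (\<Sum>l=1..v. 1 / real v * comparison_vector l i)"
      using that by (intro sum.cong refl) (simp add: w)
    finally show ?thesis by (simp only: average_vector_mean_comparison[OF v that])
  qed
  then show "\<forall>i\<in>{0..v}. information_map v d q \<xi> u i = average_vector v i" by blast
  have avg: "average_comparison_lse v (d * q) t b ?Y = (\<lambda>\<omega>. \<Sum>i=0..v. average_vector v i * ?fit \<omega> i)"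
    by (simp only: sum_average_vector) (simp add: average_comparison_lse_def Let_def fun_eq_iff)
  have "covariance P (average_comparison_lse v (d * q) t b ?Y) (average_comparison_lse v (d * q) t b ?Y)
      = \<sigma>\<^sup>2 * (\<Sum>i=0..v. u i * average_vector v i)"
    unfolding avg by (rule covariance_estimable_contrasts[OF assms(1) err design q layout u u])
  with feas show "average_criterion P v d q \<mu> \<tau> \<theta> \<epsilon> \<xi> t b
      = ereal (\<sigma>\<^sup>2 * (\<Sum>i=0..v. u i * average_vector v i))"
    by (simp only: average_criterion_def var if_True)
  have cmp: "control_comparison_lse (d * q) t b ?Y l = (\<lambda>\<omega>. \<Sum>i=0..v. comparison_vector l i * ?fit \<omega> i)"
    if "l \<in> {1..v}" for l
    by (simp only: sum_comparison_vector[OF that])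
      (simp add: control_comparison_lse_def Let_def fun_eq_iff)
  have cov: "covariance P (control_comparison_lse (d * q) t b ?Y i) (control_comparison_lse (d * q) t b ?Y l)
      = C i l" if i: "i \<in> {1..v}" and l: "l \<in> {1..v}" for i l
  proof -
    have "covariance P (control_comparison_lse (d * q) t b ?Y i) (control_comparison_lse (d * q) t b ?Y l)
        = \<sigma>\<^sup>2 * (\<Sum>m=0..v. w i m * comparison_vector l m)"
      unfolding cmp[OF i] cmp[OF l]
      by (rule covariance_estimable_contrasts[OF assms(1) err design q layout w[OF i] w[OF l]])
    then show ?thesis using sum_comparison_vector[OF l, of "w i"] by (simp add: C_def mult.commute)
  qed
  show "absolute_covariance_criterion P v d q \<mu> \<tau> \<theta> \<epsilon> \<xi> t b
      = ereal ((\<Sum>i=1..v. C i i) + (\<Sum>i=1..v. \<Sum>l\<in>{1..v} - {i}. \<bar>C i l\<bar>))"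
    using feas cov by (simp add: absolute_covariance_criterion_def Let_def var)
  have "(\<Sum>i=1..v. C i i) + (\<Sum>i=1..v. \<Sum>l\<in>{1..v} - {i}. C i l) = (\<Sum>i=1..v. \<Sum>l=1..v. C i l)"
    unfolding sum.distrib[symmetric] by (intro sum.cong refl sum.remove[symmetric]) auto
  also have "\<dots> = (\<Sum>l=1..v. \<Sum>i=1..v. \<sigma>\<^sup>2 * (w i l - w i 0))"
    unfolding C_def by (rule sum.swap)
  also have "\<dots> = \<sigma>\<^sup>2 * (\<Sum>l=1..v. (\<Sum>i=1..v. w i l) - (\<Sum>i=1..v. w i 0))"
    by (simp only: sum_distrib_left sum_subtractf right_diff_distrib)
  also have "(\<Sum>l=1..v. (\<Sum>i=1..v. w i l) - (\<Sum>i=1..v. w i 0))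
      = (\<Sum>l=1..v. real v * u l - real v * u 0)"
    using v by (simp add: u_def flip: sum_divide_distrib)
  also have "\<dots> = (real v)\<^sup>2 * (\<Sum>i=0..v. u i * average_vector v i)"
  proof -
    have "(\<Sum>i=0..v. u i * average_vector v i) = (\<Sum>l=1..v. u l) / real v - u 0"
      by (simp only: mult.commute[of "u _"] sum_average_vector)
    moreover have "(\<Sum>l=1..v. real v * u l - real v * u 0) = real v * (\<Sum>l=1..v. u l) - (real v)\<^sup>2 * u 0"
      by (simp add: sum_subtractf power2_eq_square flip: sum_distrib_left)
    ultimately show ?thesis using v by (simp add: power2_eq_square right_diff_distrib)
  qed
  finally show "(real v)\<^sup>2 * (\<sigma>\<^sup>2 * (\<Sum>i=0..v. u i * average_vector v i))
      = (\<Sum>i=1..v. C i i) + (\<Sum>i=1..v. \<Sum>l\<in>{1..v} - {i}. C i l)"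
    by simp
qed

text \<open>Cauchy-Schwarz for the form \<open>M\<close>, applied to \<open>u\<close> and the indicator \<open>s\<close> of the test treatments:
\<open>s\<^sup>T M u = 1\<close> and \<open>s\<^sup>T M s = S/q\<close>. The bound is stated without a division, so that it also shows
\<open>S > 0\<close> for every feasible design.\<close>

lemma average_variance_lower_bound:
  assumes design: "\<xi> \<in> block_designs v d q" and q: "q \<ge> 1" and v: "v \<ge> 1"
    and u: "\<forall>i\<in>{0..v}. information_map v d q \<xi> u i = average_vector v i"
  shows "real q \<le> (\<Sum>i=0..v. u i * average_vector v i) * real (\<Sum>k=1..d. \<xi> 0 k * (q - \<xi> 0 k))"
proof -
  define s where "s i = (if i = 0 then 0 else 1 :: real)" for i :: nat
  have us: "(\<Sum>i=0..v. s i * information_map v d q \<xi> u i) = 1"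
    using u v sum_average_vector[of v s] by (simp add: mult.commute[of "s _"]) (simp add: s_def)
  have uu: "(\<Sum>i=0..v. u i * information_map v d q \<xi> u i) = (\<Sum>i=0..v. u i * average_vector v i)"
    using u by simp
  have "(\<Sum>i=0..v. s i * information_map v d q \<xi> s i) = (\<Sum>i=1..v. real (concurrence d \<xi> 0 i)) / real q"
    using information_map_test_indicator[OF design q]
    by (simp add: s_def[abs_def] sum_split_control sum_divide_distrib)
  also have "\<dots> = real (\<Sum>k=1..d. \<xi> 0 k * (q - \<xi> 0 k)) / real q"
    by (simp only: of_nat_sum[symmetric] control_concurrence_sum[OF design q])
  finally have "1\<^sup>2 \<le> (\<Sum>i=0..v. u i * average_vector v i)
      * (real (\<Sum>k=1..d. \<xi> 0 k * (q - \<xi> 0 k)) / real q)"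
    using information_cauchy_schwarz[OF design q, of s u] unfolding us uu by (simp only:)
  then have "1 \<le> ((\<Sum>i=0..v. u i * average_vector v i)
      * real (\<Sum>k=1..d. \<xi> 0 k * (q - \<xi> 0 k))) / real q"
    by (simp only: times_divide_eq_right power_one)
  then show ?thesis using q by (simp only: le_divide_eq_1) linarith
qed

text \<open>Equality holds in the bound because under equal control concurrences \<open>M s = (S/q) a\<close>, so that \<open>u\<close> and
\<open>(q/S) s\<close> have the same image under \<open>M\<close>. The factor \<open>v\<close> in the hypothesis reflects that the \<open>v\<close> equal
concurrences add up to \<open>S\<close>.\<close>

lemma average_variance_balanced:
  assumes design: "\<xi> \<in> block_designs v d q" and q: "q \<ge> 1" and v: "v \<ge> 1"
    and u: "\<forall>i\<in>{0..v}. information_map v d q \<xi> u i = average_vector v i"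
    and balanced: "\<And>i. i \<in> {1..v} \<Longrightarrow> real v * real (concurrence d \<xi> 0 i) = S"
    and S: "S = real (\<Sum>k=1..d. \<xi> 0 k * (q - \<xi> 0 k))"
  shows "(\<Sum>i=0..v. u i * average_vector v i) * S = real q"
proof -
  define s where "s i = (if i = 0 then 0 else 1 :: real)" for i :: nat
  have total: "(\<Sum>m=1..v. real (concurrence d \<xi> 0 m)) = S"
    unfolding S control_concurrence_sum[OF design q, symmetric] by simp
  have s: "information_map v d q \<xi> s i = S / real q * average_vector v i" if "i \<in> {0..v}" for i
    using that v q balanced[of i] total
    by (auto simp: s_def[abs_def] information_map_test_indicator[OF design q] average_vector_def
        field_simps)
  have "S / real q * (\<Sum>i=0..v. u i * average_vector v i) = (\<Sum>i=0..v. u i * information_map v d q \<xi> s i)"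
    using s by (simp add: sum_distrib_left mult_ac)
  also have "\<dots> = (\<Sum>i=0..v. s i * average_vector v i)"
    using information_map_symmetric[OF design q, of u s] u by simp
  also have "\<dots> = 1"
    using v sum_average_vector[of v s] by (simp add: mult.commute[of "s _"]) (simp add: s_def)
  finally show ?thesis using q by (simp add: field_simps)
qed

text \<open>The treatments are connected through the control. If \<open>r\<close> is the residual of projecting \<open>e\<^sub>l - e\<^sub>0\<close> onto the
column space of the symmetric matrix \<open>M\<close>, then \<open>M r = 0\<close>, and the minimum principle for \<open>r\<close> and \<open>-r\<close> makes \<open>r\<close>
constant. A constant vector is orthogonal to \<open>e\<^sub>l - e\<^sub>0\<close>, and \<open>r\<close> is orthogonal to the column space, hence to
itself.\<close>

lemma feasible_if_control_meets_all:
  assumes design: "\<xi> \<in> block_designs v d q" and q: "q \<ge> 1"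
    and conn: "\<And>i. i \<in> {1..v} \<Longrightarrow> concurrence d \<xi> 0 i > 0"
  shows "feasible v d q \<xi>"
  unfolding feasible_iff_comparisons
proof
  fix l assume l: "l \<in> {1..v}"
  \<comment> \<open>\<open>A k\<close> is the \<open>k\<close>-th column of \<open>M\<close>.\<close>
  define A where "A k = information_map v d q \<xi> (\<lambda>i. if i = k then 1 else 0)" for k
  obtain c where "\<forall>k\<in>{0..v}.
      (\<Sum>i=0..v. (comparison_vector l i - (\<Sum>m=0..v. c m * A m i)) * A k i) = 0"
    using normal_equations_solvable[OF finite_atLeastAtMost] by (rule exE)
  then have c: "(\<Sum>i=0..v. (comparison_vector l i - (\<Sum>m=0..v. c m * A m i)) * A k i) = 0"
    if "k \<in> {0..v}" for k
    using that by (rule bspec)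
  have fit: "(\<Sum>m=0..v. c m * A m i) = information_map v d q \<xi> c i" if "i \<in> {0..v}" for i
  proof -
    have "(\<Sum>m=0..v. c m * A m i)
        = information_map v d q \<xi> (\<lambda>i. \<Sum>m=0..v. c m * (if i = m then 1 else 0)) i"
      by (simp only: A_def information_map_linear)
    also have "\<dots> = information_map v d q \<xi> c i"
    proof (rule information_map_cong)
      fix i assume i: "i \<in> {0..v}"
      have "(\<Sum>m=0..v. c m * (if i = m then 1 else 0)) = (\<Sum>m=0..v. if i = m then c m else 0)"
        by (intro sum.cong) auto
      then show "(\<Sum>m=0..v. c m * (if i = m then 1 else 0)) = c i" using i by simp
    qed (rule that)
    finally show ?thesis .
  qed
  define r where "r i = comparison_vector l i - information_map v d q \<xi> c i" for i
  have null: "information_map v d q \<xi> r k = 0" if k: "k \<in> {0..v}" for k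
  proof -
    have "information_map v d q \<xi> r k
        = (\<Sum>i=0..v. (if i = k then 1 else 0) * information_map v d q \<xi> r i)"
    proof -
      have "(\<Sum>i=0..v. (if i = k then 1 else 0) * information_map v d q \<xi> r i)
          = (\<Sum>i=0..v. if i = k then information_map v d q \<xi> r i else 0)"
        by (intro sum.cong) auto
      then show ?thesis using k by simp
    qed
    also have "\<dots> = (\<Sum>i=0..v. r i * A k i)"
      unfolding A_def by (rule information_map_symmetric[OF design q])
    also have "\<dots> = 0" using c[OF k] fit by (simp add: r_def)
    finally show ?thesis .
  qed
  have const: "r i = r 0" if i: "i \<in> {0..v}" for i
  proof (rule antisym)
    show "r 0 \<le> r i"
      using information_minimum_principle[OF design q conn _ i, of r] null by simp
    show "r i \<le> r 0"
      using information_minimum_principle[OF design q conn _ i, of "\<lambda>i. - r i"] null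
      by (simp add: information_map_uminus)
  qed
  have "(\<Sum>i=0..v. r i * r i) = (\<Sum>i=0..v. comparison_vector l i * r i)
      - (\<Sum>i=0..v. r i * information_map v d q \<xi> c i)"
    unfolding sum_subtractf[symmetric]
    by (intro sum.cong refl) (simp add: r_def algebra_simps)
  also have "(\<Sum>i=0..v. r i * information_map v d q \<xi> c i) = 0"
    unfolding information_map_symmetric[OF design q, of r c] using null by simp
  also have "(\<Sum>i=0..v. comparison_vector l i * r i) = 0"
    using const[of l] l by (simp add: sum_comparison_vector[OF l])
  finally have "\<forall>i\<in>{0..v}. r i = 0"
    by (subst (asm) diff_zero, subst (asm) sum_nonneg_eq_0_iff) auto
  then show "\<exists>w. \<forall>i\<in>{0..v}. information_map v d q \<xi> w i = comparison_vector l i"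
    by (intro exI[of _ c]) (auto simp: r_def)
qed

text \<open>The difference of the two sides is \<open>(x - y) (x - (q - y))\<close>. It is nonnegative because no integer lies
strictly between \<open>y\<close> and \<open>q - y\<close>, which are equal or consecutive.\<close>

lemma balanced_split_maximal:
  fixes x y q :: nat
  assumes "even q \<Longrightarrow> y = q div 2" and "odd q \<Longrightarrow> y \<in> {q div 2, q div 2 + 1}"
    and "x \<le> q"
  shows "x * (q - x) \<le> y * (q - y)"
proof -
  have yq: "y \<le> q" and close: "y = q - y \<or> y = q - y + 1 \<or> q - y = y + 1"
    using assms(1,2) by (cases "even q"; auto elim!: evenE oddE)+
  have "int y = int q - int y \<or> int y = int q - int y + 1 \<or> int q - int y = int y + 1"
    using close yq by linarith
  moreover have "(int x - int y) * (int x - (int q - int y)) \<ge> 0"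
    if "int y = int q - int y \<or> int y = int q - int y + 1 \<or> int q - int y = int y + 1"
  proof (cases "int x \<le> int y \<and> int x \<le> int q - int y")
    case True
    then show ?thesis by (intro mult_nonpos_nonpos) auto
  next
    case False
    with that show ?thesis by (intro mult_nonneg_nonneg) auto
  qed
  ultimately have "int x * (int q - int x) \<le> int y * (int q - int y)"
    by (simp add: algebra_simps)
  then show ?thesis
    using yq assms(3) by (metis of_nat_diff of_nat_le_iff of_nat_mult)
qed

theorem theorem4:
  fixes v d q :: nat
    and P :: "'p measure"
    and \<mu> \<sigma> :: real
    and \<tau> \<theta> :: "nat \<Rightarrow> real"
    and \<epsilon> :: "nat \<Rightarrow> 'p \<Rightarrow> real"
    and \<xi>' :: "nat \<Rightarrow> nat \<Rightarrow> nat"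
    and t' b' :: "nat \<Rightarrow> nat"
  assumes "v \<ge> 1" and "d \<ge> 1" and "q \<ge> 1"
    and "prob_space P"
    and "uncorrelated_errors P (d * q) \<sigma> \<epsilon>"
    and "\<xi>' \<in> block_designs v d q"
    and "realizes v d q \<xi>' t' b'"
    and "even q \<Longrightarrow> \<forall>k\<in>{1..d}. \<xi>' 0 k = q div 2"
    and "odd q \<Longrightarrow> \<forall>k\<in>{1..d}. \<xi>' 0 k \<in> {q div 2, q div 2 + 1}"
    and "\<forall>i\<in>{1..v}. \<forall>j\<in>{1..v}. concurrence d \<xi>' 0 i = concurrence d \<xi>' 0 j"
  shows "(\<forall>\<xi>\<in>block_designs v d q. \<forall>t b. realizes v d q \<xi> t b \<longrightarrow>
           average_criterion P v d q \<mu> \<tau> \<theta> \<epsilon> \<xi>' t' b'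
             \<le> average_criterion P v d q \<mu> \<tau> \<theta> \<epsilon> \<xi> t b) \<and>
         (\<forall>\<xi>\<in>block_designs v d q. \<forall>t b. realizes v d q \<xi> t b \<longrightarrow>
           absolute_covariance_criterion P v d q \<mu> \<tau> \<theta> \<epsilon> \<xi>' t' b'
             \<le> absolute_covariance_criterion P v d q \<mu> \<tau> \<theta> \<epsilon> \<xi> t b)"
proof -
  have v: "v \<ge> 1" and q: "q \<ge> 1" and prob: "prob_space P"
    and err: "uncorrelated_errors P (d * q) \<sigma> \<epsilon>" and design': "\<xi>' \<in> block_designs v d q"
    and layout': "realizes v d q \<xi>' t' b'"
    using assms by blast+
  define S where "S \<xi> = (\<Sum>k=1..d. \<xi> 0 k * (q - \<xi> 0 k))" for \<xi> :: "nat \<Rightarrow> nat \<Rightarrow> nat"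
  have S_max: "S \<xi> \<le> S \<xi>'" if "\<xi> \<in> block_designs v d q" for \<xi>
    unfolding S_def
  proof (intro sum_mono balanced_split_maximal)
    fix k assume k: "k \<in> {1..d}"
    show "\<xi>' 0 k = q div 2" if "even q" using assms(8) that k by blast
    show "\<xi>' 0 k \<in> {q div 2, q div 2 + 1}" if "odd q" using assms(9) that k by blast
    have "(\<Sum>i=0..v. \<xi> i k) = q" using that k by (auto simp: block_designs_def)
    then show "\<xi> 0 k \<le> q" by (simp add: sum_split_control)
  qed
  have balanced: "v * concurrence d \<xi>' 0 i = S \<xi>'" if "i \<in> {1..v}" for i
  proof -
    have "S \<xi>' = (\<Sum>m=1..v. concurrence d \<xi>' 0 m)"
      unfolding S_def by (rule control_concurrence_sum[OF design' q, symmetric])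
    also have "\<dots> = (\<Sum>m=1..v. concurrence d \<xi>' 0 i)"
      using assms(10) that by (intro sum.cong refl) blast
    finally show ?thesis by simp
  qed
  have "average_criterion P v d q \<mu> \<tau> \<theta> \<epsilon> \<xi>' t' b' \<le> average_criterion P v d q \<mu> \<tau> \<theta> \<epsilon> \<xi> t b
      \<and> absolute_covariance_criterion P v d q \<mu> \<tau> \<theta> \<epsilon> \<xi>' t' b'
        \<le> absolute_covariance_criterion P v d q \<mu> \<tau> \<theta> \<epsilon> \<xi> t b"
    if design: "\<xi> \<in> block_designs v d q" and layout: "realizes v d q \<xi> t b" for \<xi> t b
  proof (cases "feasible v d q \<xi>")
    case False
    then show ?thesis by (simp add: average_criterion_def absolute_covariance_criterion_def)
  next
    case feas: True
    obtain w where w: "\<forall>l\<in>{1..v}. \<forall>i\<in>{0..v}. information_map v d q \<xi> (w l) i = comparison_vector l i"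
      using feas unfolding feasible_iff_comparisons by metis
    define u where "u i = (\<Sum>l=1..v. 1 / real v * w l i)" for i
    define C where "C i l = \<sigma>\<^sup>2 * (w i l - w i 0)" for i l
    define V where "V = (\<Sum>i=0..v. u i * average_vector v i)"
    note crit = criteria_of_feasible_design[OF prob err design q layout feas v w,
        folded u_def C_def, folded V_def]
    have bound: "real q \<le> V * real (S \<xi>)"
      unfolding V_def S_def by (rule average_variance_lower_bound[OF design q v crit(1)])
    with q have "0 < V * real (S \<xi>)" by linarith
    then have V: "V > 0" and S_pos: "S \<xi> > 0"
      using of_nat_0_le_iff[of "S \<xi>", where 'a = real] by (auto simp: zero_less_mult_iff)

    \<comment> \<open>A feasible competitor forces \<open>S \<xi>' > 0\<close>. This excludes blocks of size one, where no design is
      feasible, and makes the control of the candidate meet every test.\<close>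
    have conn: "concurrence d \<xi>' 0 i > 0" if "i \<in> {1..v}" for i
      using balanced[OF that] S_max[OF design] S_pos by (intro gr0I) auto
    have feas': "feasible v d q \<xi>'"
      by (rule feasible_if_control_meets_all[OF design' q conn])
    obtain w' where w': "\<forall>l\<in>{1..v}. \<forall>i\<in>{0..v}. information_map v d q \<xi>' (w' l) i = comparison_vector l i"
      using feas' unfolding feasible_iff_comparisons by metis
    define u' where "u' i = (\<Sum>l=1..v. 1 / real v * w' l i)" for i
    define C' where "C' i l = \<sigma>\<^sup>2 * (w' i l - w' i 0)" for i l
    define V' where "V' = (\<Sum>i=0..v. u' i * average_vector v i)"
    note crit' = criteria_of_feasible_design[OF prob err design' q layout' feas' v w',
        folded u'_def C'_def, folded V'_def]
    have "V' * real (S \<xi>') = real q"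
      unfolding V'_def
      by (rule average_variance_balanced[OF design' q v crit'(1)])
        (use balanced S_def in \<open>auto simp flip: of_nat_mult\<close>)
    also have "\<dots> \<le> V * real (S \<xi>')"
      using bound V S_max[OF design] by (meson less_imp_le mult_left_mono of_nat_mono order_trans)
    finally have "V' \<le> V"
      using S_pos S_max[OF design] by (simp add: mult_le_cancel_right)
    then have le: "\<sigma>\<^sup>2 * V' \<le> \<sigma>\<^sup>2 * V" by (simp add: mult_left_mono)

    \<comment> \<open>Row \<open>i\<close> of the covariance matrix comes from \<open>M w = e\<^sub>i - e\<^sub>0\<close>, which is nonnegative at all tests.\<close>
    have C'_nonneg: "C' i l \<ge> 0" if i: "i \<in> {1..v}" and l: "l \<in> {1..v}" for i l
    proof -
      have "w' i 0 \<le> w' i l"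
      proof (rule information_minimum_principle[OF design' q conn])
        show "0 \<le> information_map v d q \<xi>' (w' i) m" if "m \<in> {1..v}" for m
          using w' i that by (simp add: comparison_vector_def)
      qed (use l in auto)
      then show ?thesis by (simp add: C'_def)
    qed
    have "(\<Sum>i=1..v. C' i i) + (\<Sum>i=1..v. \<Sum>l\<in>{1..v} - {i}. \<bar>C' i l\<bar>)
        = (\<Sum>i=1..v. C' i i) + (\<Sum>i=1..v. \<Sum>l\<in>{1..v} - {i}. C' i l)"
      using C'_nonneg by simp
    also have "\<dots> = (real v)\<^sup>2 * (\<sigma>\<^sup>2 * V')" by (rule crit'(4)[symmetric])
    also have "\<dots> \<le> (real v)\<^sup>2 * (\<sigma>\<^sup>2 * V)" using le by (simp add: mult_left_mono)
    also have "\<dots> = (\<Sum>i=1..v. C i i) + (\<Sum>i=1..v. \<Sum>l\<in>{1..v} - {i}. C i l)" by (rule crit(4))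
    also have "\<dots> \<le> (\<Sum>i=1..v. C i i) + (\<Sum>i=1..v. \<Sum>l\<in>{1..v} - {i}. \<bar>C i l\<bar>)"
      by (intro add_left_mono sum_mono) simp
    finally show ?thesis using le unfolding crit(2,3) crit'(2,3) by simp
  qed
  then show ?thesis by blast
qed

end
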